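(* Let $\|\cdot\|$ be a norm on $\mathbb{C}^n$. Then $\|\cdot\|$ is absolute if and only if it is monotone.
   Context: For $\mathbf{x}=[x_i]\in\mathbb{C}^n$, let $|\mathbf{x}|:=(|x_1|,|x_2|,\ldots,|x_n|)\in\mathbb{R}^n$. For $\mathbf{x},\mathbf{y}\in\mathbb{R}^n$, write $\mathbf{x}\leq_{\mathrm{e}}\mathbf{y}$ if $x_j\leq y_j$ for all $1\leq j\leq n$. A norm $\|\cdot\|$ on $\mathbb{C}^n$ is monotone if for all $\mathbf{x},\mathbf{y}\in\mathbb{C}^n$, $|\mathbf{x}|\leq_{\mathrm{e}}|\mathbf{y}|$ implies $\|\mathbf{x}\|\leq\|\mathbf{y}\|$. It is absolute if $\|\,|\mathbf{x}|\,\|=\|\mathbf{x}\|$ for all $\mathbf{x}\in\mathbb{C}^n$. *)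

theory Defs
  imports "HOL-Analysis.Analysis"
begin

(* A norm on C^n is an arbitrary function satisfying the norm axioms; the library constant
   "norm" on complex ^ 'n is only one instance (the Euclidean norm). Homogeneity is with
   respect to complex scalars. *)
definition is_norm :: "(complex ^ 'n \<Rightarrow> real) \<Rightarrow> bool" where
  "is_norm N \<longleftrightarrow>
     (\<forall>x. 0 \<le> N x) \<and>
     (\<forall>x. N x = 0 \<longleftrightarrow> x = 0) \<and>
     (\<forall>c x. N (c *s x) = cmod c * N x) \<and>
     (\<forall>x y. N (x + y) \<le> N x + N y)"

definition vec_abs :: "complex ^ 'n \<Rightarrow> real ^ 'n" where
  "vec_abs x = (\<chi> i. cmod (x $ i))"

(* The inclusion of R^n in C^n, needed to apply a norm on C^n to the real vector |x|. *)
definition complex_of_real_vec :: "real ^ 'n \<Rightarrow> complex ^ 'n" where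
  "complex_of_real_vec x = (\<chi> i. complex_of_real (x $ i))"

(* The library order on real ^ 'n is the entrywise one (less_eq_vec_def). *)
definition monotone_norm :: "(complex ^ 'n \<Rightarrow> real) \<Rightarrow> bool" where
  "monotone_norm N \<longleftrightarrow> (\<forall>x y. vec_abs x \<le> vec_abs y \<longrightarrow> N x \<le> N y)"

definition absolute_norm :: "(complex ^ 'n \<Rightarrow> real) \<Rightarrow> bool" where
  "absolute_norm N \<longleftrightarrow> (\<forall>x. N (complex_of_real_vec (vec_abs x)) = N x)"

end

theory Submission
  imports Defs
begin

text \<open>
  A monotone norm is absolute because \<open>x\<close> and \<open>|x|\<close> have the same entrywise moduli.

  Conversely, an absolute norm depends only on the entrywise moduli, so negating one coordinate
  of \<open>y\<close> does not change the norm.  Multiplying that coordinate by some \<open>t \<in> [0, 1]\<close> produces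
  the convex combination, with weights \<open>(1 + t) / 2\<close> and \<open>(1 - t) / 2\<close>, of \<open>y\<close> and the negated
  vector; hence it does not increase the norm (\<open>absolute_norm_shrink_coordinate\<close>).  If
  \<open>|x| \<le> |y|\<close> entrywise, then \<open>y\<close> can be turned into \<open>x\<close>, up to phases, by shrinking one
  coordinate after the other.
\<close>

lemma vec_abs_complex_of_real_vec_vec_abs:
  "vec_abs (complex_of_real_vec (vec_abs x)) = vec_abs x"
  by (simp add: vec_abs_def complex_of_real_vec_def vec_eq_iff)

lemma absolute_norm_eqI:
  assumes "absolute_norm N" and "vec_abs x = vec_abs y"
  shows "N x = N y"
  using assms unfolding absolute_norm_def by metis

lemma absolute_norm_shrink_coordinate:
  fixes N :: "complex ^ 'n \<Rightarrow> real"
  assumes N: "is_norm N" and abs: "absolute_norm N"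
    and le: "cmod c \<le> cmod (y $ k)"
  shows "N (\<chi> i. if i = k then c else y $ i) \<le> N y"
proof -
  define t where "t = cmod c / cmod (y $ k)"
  have t: "0 \<le> t" "t \<le> 1" "t * cmod (y $ k) = cmod c"
    \<comment> \<open>If \<open>y $ k = 0\<close> then also \<open>c = 0\<close>, and the default value \<open>t = 0\<close> is correct.\<close>
    using le by (auto simp: t_def divide_le_eq_1)
  define y' where "y' = (\<chi> i. if i = k then - y $ k else y $ i)"
  define w where "w = (\<chi> i. if i = k then of_real t * y $ k else y $ i)"
  have "N (\<chi> i. if i = k then c else y $ i) = N w"
    using t by (intro absolute_norm_eqI[OF abs])
      (simp add: vec_abs_def w_def vec_eq_iff norm_mult)
  also have "w = of_real ((1 + t) / 2) *s y + of_real ((1 - t) / 2) *s y'"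
    by (simp add: w_def y'_def vec_eq_iff field_simps)
  also have "N \<dots> \<le> N (of_real ((1 + t) / 2) *s y) + N (of_real ((1 - t) / 2) *s y')"
    using N unfolding is_norm_def by blast
  also have "\<dots> = \<bar>(1 + t) / 2\<bar> * N y + \<bar>(1 - t) / 2\<bar> * N y'"
    using N unfolding is_norm_def by (simp only: norm_of_real)
  also have "N y' = N y"
    by (intro absolute_norm_eqI[OF abs]) (simp add: vec_abs_def y'_def vec_eq_iff)
  also have "\<bar>(1 + t) / 2\<bar> * N y + \<bar>(1 - t) / 2\<bar> * N y = N y"
    using t by (simp add: field_simps)
  finally show ?thesis .
qed

text \<open>The set \<open>S\<close> contains the coordinates that still have to be shrunk.\<close>

lemma absolute_norm_mono_on_coordinates:
  fixes N :: "complex ^ 'n \<Rightarrow> real"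
  assumes N: "is_norm N" and abs: "absolute_norm N" and "finite S"
    and "\<And>i. cmod (x $ i) \<le> cmod (y $ i)"
    and "\<And>i. i \<notin> S \<Longrightarrow> cmod (x $ i) = cmod (y $ i)"
  shows "N x \<le> N y"
  using assms(3-5)
proof (induction S arbitrary: y rule: finite_induct)
  case empty
  then have "N x = N y"
    by (intro absolute_norm_eqI[OF abs]) (simp add: vec_abs_def)
  then show ?case by simp
next
  case (insert k S)
  define z where "z = (\<chi> i. if i = k then x $ k else y $ i)"
  have "N x \<le> N z"
    using insert.prems by (intro insert.IH) (auto simp: z_def)
  also have "N z \<le> N y"
    unfolding z_def using insert.prems(1) by (intro absolute_norm_shrink_coordinate[OF N abs])
  finally show ?case .
qed

theorem lemma3p1:
  fixes N :: "complex ^ 'n \<Rightarrow> real"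
  assumes "is_norm N"
  shows "absolute_norm N \<longleftrightarrow> monotone_norm N"
proof
  assume abs: "absolute_norm N"
  show "monotone_norm N"
    unfolding monotone_norm_def
  proof (intro allI impI)
    fix x y :: "complex ^ 'n"
    assume "vec_abs x \<le> vec_abs y"
    then show "N x \<le> N y"
      by (intro absolute_norm_mono_on_coordinates[OF assms abs, of UNIV])
        (auto simp: vec_abs_def less_eq_vec_def)
  qed
next
  assume "monotone_norm N"
  then show "absolute_norm N"
    unfolding monotone_norm_def absolute_norm_def
    by (metis antisym order_refl vec_abs_complex_of_real_vec_vec_abs)
qed

end
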